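(* Let $k\ge 0$ be an integer, let $p_1,\dots,p_k$ be distinct primes, and let $\Gamma_k$ be the $k$-dprime divisor function graph of $n=p_1p_2\cdots p_k$. Then the Wiener index of $\Gamma_k$ is $$W(\Gamma_k)=2^{2k}-3^k.$$
   Context: For $n=p_1p_2\cdots p_k$ with $p_1,\dots,p_k$ distinct primes, the $k$-dprime divisor function graph $\Gamma_k=G_{D(n)}$ is the simple graph with vertex set $V(\Gamma_k)=\{u\in\mathbb{Z}_{>0}: u\mid n\}$ and edge set $E(\Gamma_k)=\{uv: u\neq v,\ u\mid v \text{ or } v\mid u\}$. The Wiener index is $W(\Gamma_k)=\sum_{\{u,v\}\subseteq V(\Gamma_k)} d_{\Gamma_k}(u,v)$, summed over unordered pairs of distinct vertices, where $d_{\Gamma_k}$ is the shortest-path distance. *)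

theory Defs
  imports
    "HOL-Computational_Algebra.Primes"
    "Graph_Theory.Pair_Digraph"
    "Graph_Theory.Shortest_Path"
begin

text \<open>As usual for this graph library, a simple graph is a symmetric loop-free digraph: an edge
  \<open>uv\<close> is the pair of arcs \<open>(u, v)\<close> and \<open>(v, u)\<close>.\<close>

definition divisor_graph :: "nat \<Rightarrow> nat pair_pre_digraph" where
  "divisor_graph n =
    \<lparr> pverts = {u. 0 < u \<and> u dvd n},
      parcs = {(u, v). u \<in> {u. 0 < u \<and> u dvd n} \<and> v \<in> {u. 0 < u \<and> u dvd n} \<and>
                       u \<noteq> v \<and> (u dvd v \<or> v dvd u)} \<rparr>"

lemma pair_graph_divisor_graph:
  assumes "0 < n"
  shows "pair_graph (divisor_graph n)"
proof -
  let ?V = "{u. 0 < u \<and> u dvd n}"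
  have fin: "finite ?V"
    using assms by (auto intro: finite_subset[of _ "{..n}"] dest: dvd_imp_le)
  have "parcs (divisor_graph n) \<subseteq> ?V \<times> ?V"
    by (auto simp: divisor_graph_def)
  then have "finite (parcs (divisor_graph n))"
    using fin by (meson finite_SigmaI finite_subset)
  then show ?thesis
    using fin by unfold_locales (auto simp: divisor_graph_def symmetric_def intro!: symI)
qed

text \<open>The shortest-path distance is the infimum of the costs of all walks for unit arc weights;
  it is \<open>\<infinity>\<close> when there is no walk.\<close>

definition graph_dist :: "('a, 'b) pre_digraph \<Rightarrow> 'a \<Rightarrow> 'a \<Rightarrow> ereal" where
  "graph_dist G u v = wf_digraph.\<mu> G (\<lambda>_. 1) u v"

text \<open>The index ranges over the two-element sets \<open>{u, v}\<close> of vertices. For a symmetric digraph the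
  distance depends only on the set, see \<open>graph_dist_unordered\<close> below.\<close>

definition wiener_index :: "('a, 'b) pre_digraph \<Rightarrow> ereal" where
  "wiener_index G =
    (\<Sum>e | e \<subseteq> verts G \<and> card e = 2. THE d. \<forall>u v. e = {u, v} \<longrightarrow> d = graph_dist G u v)"

lemma (in sym_digraph) awalk_reverse:
  assumes "awalk u p v"
  shows "\<exists>q. awalk v q u \<and> length q = length p"
  using assms
proof (induction p arbitrary: u)
  case Nil
  then show ?case by (auto simp: awalk_Nil_iff intro!: exI[of _ "[]"])
next
  case (Cons a p)
  then have a: "a \<in> arcs G" "tail G a = u" and p: "awalk (head G a) p v"
    by (auto simp: awalk_Cons_iff)
  from Cons.IH[OF p] obtain q where q: "awalk v q (head G a)" "length q = length p" by blast
  from sym_arcs a obtain b where b: "b \<in> arcs G" "tail G b = head G a" "head G b = u"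
    unfolding symmetric_conv by metis
  have "awalk (head G a) [b] u"
    using b by (auto simp: awalk_Cons_iff awalk_Nil_iff)
  with q have "awalk v (q @ [b]) u" by (blast intro: awalk_appendI)
  with q show ?case by (intro exI[of _ "q @ [b]"]) auto
qed

lemma (in sym_digraph) graph_dist_commute: "graph_dist G u v = graph_dist G v u"
proof -
  have cost: "awalk_cost (\<lambda>_. 1) p = real (length p)" for p :: "'b list"
    by (induction p) auto
  have le: "\<mu> (\<lambda>_. 1) x y \<le> \<mu> (\<lambda>_. 1) y x" for x y
  proof -
    have "\<exists>q. awalk x q y \<and> awalk_cost (\<lambda>_. 1) q \<le> awalk_cost (\<lambda>_. 1) p" if "awalk y p x" for p
      using awalk_reverse[OF that] by (auto simp: cost)
    then show ?thesis
      unfolding \<mu>_def by (auto intro!: INF_mono)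
  qed
  show ?thesis
    unfolding graph_dist_def by (intro antisym le)
qed

lemma (in sym_digraph) graph_dist_unordered:
  "(THE d. \<forall>x y. {u, v} = {x, y} \<longrightarrow> d = graph_dist G x y) = graph_dist G u v"
  by (rule the_equality) (auto simp: doubleton_eq_iff graph_dist_commute)

end

theory Submission
  imports Defs
begin

text \<open>The divisor 1 is adjacent to every other vertex, so two distinct vertices are at distance 1 if
  they are comparable and 2 otherwise. Hence the index is twice the number of pairs of vertices minus
  the number of edges. Divisors of \<open>n\<close> correspond to subsets of the set of its \<open>k\<close> prime factors, so
  there are \<open>2 ^ k\<close> vertices, and the pairs \<open>A \<subseteq> B\<close> of such subsets, equality included, number
  \<open>3 ^ k\<close>; this gives \<open>2 ^ k * (2 ^ k - 1) - (3 ^ k - 2 ^ k)\<close>.\<close>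

section \<open>Distances one and two under unit arc weights\<close>

lemma (in wf_digraph) awalk_cost_unit: "awalk_cost (\<lambda>_. 1) p = real (length p)"
  by (induction p) auto

lemma (in wf_digraph) awalk_singleton:
  assumes "awalk u [a] v"
  shows "(u, v) \<in> arcs_ends G"
  using assms by (force simp: awalk_Cons_iff awalk_Nil_iff arcs_ends_conv)

lemma (in wf_digraph) dominates_imp_awalk:
  assumes "(u, v) \<in> arcs_ends G"
  shows "\<exists>a. awalk u [a] v"
  using assms by (auto simp: arcs_ends_conv dest: arc_implies_awalk)

lemma (in wf_digraph) graph_dist_le:
  assumes "awalk u p v"
  shows "graph_dist G u v \<le> ereal (real (length p))"
  unfolding graph_dist_def using min_cost_le_walk_cost[OF assms, of "\<lambda>_. 1"]
  by (simp add: awalk_cost_unit)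

lemma (in wf_digraph) graph_dist_ge:
  assumes "\<And>p. awalk u p v \<Longrightarrow> n \<le> length p"
  shows "ereal (real n) \<le> graph_dist G u v"
  unfolding graph_dist_def \<mu>_def using assms by (auto intro!: INF_greatest simp: awalk_cost_unit)

text \<open>Only the empty walk is shorter than a single arc, and \<open>u \<noteq> v\<close>
  excludes it; at a loop the distance would be 0.\<close>

lemma (in wf_digraph) graph_dist_adjacent:
  assumes "(u, v) \<in> arcs_ends G" and "u \<noteq> v"
  shows "graph_dist G u v = 1"
proof (rule antisym)
  obtain a where "awalk u [a] v"
    using dominates_imp_awalk[OF assms(1)] by blast
  from graph_dist_le[OF this] show "graph_dist G u v \<le> 1"
    by (simp add: one_ereal_def)
  have "1 \<le> length p" if "awalk u p v" for p
    using that assms(2) by (cases p) (auto simp: awalk_Nil_iff)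
  from graph_dist_ge[OF this] show "1 \<le> graph_dist G u v"
    by (simp add: one_ereal_def)
qed

text \<open>The walk through \<open>w\<close> gives the upper bound. A shorter walk is empty or a
  single arc, which the last two hypotheses exclude.\<close>

lemma (in wf_digraph) graph_dist_two:
  assumes "(u, w) \<in> arcs_ends G" "(w, v) \<in> arcs_ends G"
    and "(u, v) \<notin> arcs_ends G" "u \<noteq> v"
  shows "graph_dist G u v = 2"
proof (rule antisym)
  obtain a b where "awalk u [a] w" "awalk w [b] v"
    using assms(1,2) dominates_imp_awalk by blast
  then have "awalk u ([a] @ [b]) v"
    by (rule awalk_appendI)
  from graph_dist_le[OF this] show "graph_dist G u v \<le> 2"
    by simp
  have "2 \<le> length p" if p: "awalk u p v" for p
  proof (rule ccontr)
    assume "\<not> 2 \<le> length p"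
    then consider "p = []" | a where "p = [a]"
      by (cases p) (auto simp: Suc_le_eq)
    then show False
      using p assms(3,4) by cases (auto simp: awalk_Nil_iff dest: awalk_singleton)
  qed
  from graph_dist_ge[OF this] show "2 \<le> graph_dist G u v"
    by simp
qed

lemma (in graph) wiener_index_universal_vertex:
  assumes z: "\<And>v. v \<in> verts G \<Longrightarrow> v \<noteq> z \<Longrightarrow> (z, v) \<in> arcs_ends G"
  shows "wiener_index G = ereal (2 * real (card (verts G) choose 2)
    - real (card {{u, v} | u v. (u, v) \<in> arcs_ends G}))"
proof -
  let ?E = "{{u, v} | u v. (u, v) \<in> arcs_ends G}"
  let ?P = "{e. e \<subseteq> verts G \<and> card e = 2}"
  have sym: "(v, u) \<in> arcs_ends G" if "(u, v) \<in> arcs_ends G" for u v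
    using arcs_ends_symmetric[OF sym_arcs] that by blast
  have ne: "u \<noteq> v" if "(u, v) \<in> arcs_ends G" for u v
    using that no_loops by (auto simp: arcs_ends_conv)
  have dist: "(THE d. \<forall>u v. e = {u, v} \<longrightarrow> d = graph_dist G u v)
      = ereal (if e \<in> ?E then 1 else 2)" if P: "e \<in> ?P" for e
  proof -
    obtain u v where e: "e = {u, v}" "u \<noteq> v" "u \<in> verts G" "v \<in> verts G"
      using P by (auto simp: card_2_iff)
    have "e \<in> ?E \<longleftrightarrow> (u, v) \<in> arcs_ends G"
      using sym by (auto simp: e(1) doubleton_eq_iff)
    moreover have "graph_dist G u v = 2" if uv: "(u, v) \<notin> arcs_ends G"
    proof -
      \<comment> \<open>If one of the two vertices were \<open>z\<close>, universality and symmetry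
        would make them adjacent.\<close>
      have "u \<noteq> z" "v \<noteq> z"
        using uv e z sym by metis+
      then show ?thesis
        using uv e z sym by (intro graph_dist_two[of u z]) simp_all
    qed
    ultimately show ?thesis
      using e graph_dist_unordered[of u v] graph_dist_adjacent[of u v] by (auto simp: one_ereal_def)
  qed
  have fin: "finite ?P"
    by (auto intro: finite_subset[of _ "Pow (verts G)"])
  have E: "?E \<subseteq> ?P"
    using ne adj_in_verts by (fastforce simp: card_insert_if)
  have "wiener_index G = (\<Sum>e\<in>?P. ereal (if e \<in> ?E then 1 else 2))"
    unfolding wiener_index_def using dist by (rule sum.cong[OF refl])
  \<comment> \<open>With the distance written in the reals as 2 minus the indicator of an edge, the
    sum splits into two cardinalities.\<close>
  also have "\<dots> = ereal (\<Sum>e\<in>?P. 2 - (if e \<in> ?E then 1 else 0))"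
    by (simp only: sum_ereal) (intro arg_cong[of _ _ ereal] sum.cong, auto)
  also have "(\<Sum>e\<in>?P. 2 - (if e \<in> ?E then 1 else 0)) = 2 * real (card ?P) - real (card (?P \<inter> ?E))"
    using fin by (simp only: sum_subtractf sum.inter_restrict[symmetric]) simp
  also have "?P \<inter> ?E = ?E"
    using E by blast
  also have "card ?P = card (verts G) choose 2"
    by (rule n_subsets) simp
  finally show ?thesis .
qed

section \<open>Divisors of a squarefree number as sets of primes\<close>

lemma prod_primes_dvd_iff:
  fixes A B :: "nat set"
  assumes "finite B" "\<And>q. q \<in> B \<Longrightarrow> prime q" "finite A" "\<And>q. q \<in> A \<Longrightarrow> prime q"
  shows "\<Prod>A dvd \<Prod>B \<longleftrightarrow> A \<subseteq> B"
proof
  assume dvd: "\<Prod>A dvd \<Prod>B"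
  show "A \<subseteq> B"
  proof
    \<comment> \<open>The prime \<open>q\<close> divides \<open>\<Prod>B\<close>, hence some prime
      in \<open>B\<close>, and so equals it.\<close>
    fix q assume q: "q \<in> A"
    then have "q dvd \<Prod>B"
      using dvd assms(3) dvd_prodI[of A q "\<lambda>x. x"] dvd_trans by blast
    then obtain r where "r \<in> B" "q dvd r"
      using prime_dvd_prod_iff[of B q "\<lambda>x. x"] assms(1,4) q by auto
    then show "q \<in> B"
      using primes_dvd_imp_eq assms(2,4) q by metis
  qed
qed (use assms(1) prod_dvd_prod_subset in blast)

text \<open>By induction on \<open>P\<close>: a divisor of \<open>q * \<Prod>P\<close> splits into a
  divisor of \<open>q\<close> and one of \<open>\<Prod>P\<close>, and primality leaves only the
  choice whether \<open>q\<close> joins the set.\<close>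

lemma dvd_prod_primesE:
  fixes P :: "nat set"
  assumes "finite P" "\<And>q. q \<in> P \<Longrightarrow> prime q" "d dvd \<Prod>P"
  obtains S where "S \<subseteq> P" "d = \<Prod>S"
  using assms
proof (induction P arbitrary: d thesis rule: finite_induct)
  case empty
  then show ?case by (auto intro: empty.prems(1)[of "{}"])
next
  case (insert q P)
  then have "d dvd q * \<Prod>P" by simp
  then obtain a b where ab: "d = a * b" "a dvd q" "b dvd \<Prod>P"
    by (rule dvd_productE)
  obtain S where S: "S \<subseteq> P" "b = \<Prod>S"
    using insert.IH[OF _ _ ab(3)] insert.prems(2) by blast
  \<comment> \<open>These ensure that inserting \<open>q\<close> multiplies the product over
    \<open>S\<close> by exactly \<open>q\<close>.\<close>
  have "finite S" "q \<notin> S"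
    using S(1) insert.hyps finite_subset by auto
  have "a = 1 \<or> a = q"
    using ab(2) insert.prems(2)[of q] by (simp add: prime_nat_iff)
  then show ?case
  proof
    assume "a = 1"
    then show ?case using S ab(1) by (intro insert.prems(1)[of S]) auto
  next
    assume "a = q"
    then show ?case
      using S ab(1) \<open>finite S\<close> \<open>q \<notin> S\<close> by (intro insert.prems(1)[of "insert q S"]) auto
  qed
qed

section \<open>Counting nested pairs and edges\<close>

lemma card_subset_pairs:
  assumes "finite P"
  shows "card (SIGMA B:Pow P. Pow B) = 3 ^ card P"
proof -
  have "card (SIGMA B:Pow P. Pow B) = (\<Sum>B\<in>Pow P. 2 ^ card B)"
  proof (subst card_SigmaI)
    show "finite (Pow P)" "\<forall>B\<in>Pow P. finite (Pow B)"
      using assms by (auto intro: finite_subset)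
    show "(\<Sum>B\<in>Pow P. card (Pow B)) = (\<Sum>B\<in>Pow P. 2 ^ card B)"
      using assms by (intro sum.cong) (simp_all add: card_Pow finite_subset)
  qed
  \<comment> \<open>This is the expansion of a product of \<open>card P\<close> factors
    \<open>2 + 1\<close>: an element of \<open>B\<close> may lie in the smaller set or not, an
    element outside \<open>B\<close> has no choice.\<close>
  also have "\<dots> = (\<Sum>B\<in>Pow P. (\<Prod>x\<in>B. 2) * (\<Prod>x\<in>P - B. 1))"
    by simp
  also have "\<dots> = (\<Prod>x\<in>P. 2 + 1)"
    using assms by (rule prod_add[symmetric])
  finally show ?thesis by simp
qed

lemma bij_betw_Pow_divisors:
  fixes P :: "nat set"
  assumes "finite P" "\<And>q. q \<in> P \<Longrightarrow> prime q"
  shows "bij_betw \<Prod> (Pow P) {u. u dvd \<Prod>P}"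
  unfolding bij_betw_def
proof
  have *: "\<Prod>A dvd \<Prod>B \<longleftrightarrow> A \<subseteq> B" if "A \<subseteq> P" "B \<subseteq> P" for A B
    using that assms by (intro prod_primes_dvd_iff) (auto intro: finite_subset)
  show "inj_on \<Prod> (Pow P)"
    by (rule inj_onI) (metis "*" PowD dvd_refl subset_antisym)
  show "\<Prod> ` Pow P = {u. u dvd \<Prod>P}"
    using assms * by (auto elim: dvd_prod_primesE)
qed

text \<open>The bijection between subsets and divisors is used twice: for the outer index
  \<open>v = \<Prod>B\<close>, and for each \<open>B\<close> to count the divisors of
  \<open>\<Prod>B\<close>.\<close>

lemma card_divisor_pairs:
  fixes P :: "nat set"
  assumes "finite P" "\<And>q. q \<in> P \<Longrightarrow> prime q"
  shows "card (SIGMA v:{v. v dvd \<Prod>P}. {u. u dvd v}) = 3 ^ card P"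
proof -
  have bij: "bij_betw \<Prod> (Pow B) {u. u dvd \<Prod>B}" if "B \<subseteq> P" for B
    using that assms by (intro bij_betw_Pow_divisors) (auto intro: finite_subset)
  have "card (SIGMA v:{v. v dvd \<Prod>P}. {u. u dvd v}) = (\<Sum>v | v dvd \<Prod>P. card {u. u dvd v})"
  proof (rule card_SigmaI)
    have "\<Prod>P \<noteq> 0" using assms by (auto dest: prime_gt_0_nat)
    then show "finite {v. v dvd \<Prod>P}" "\<forall>v\<in>{v. v dvd \<Prod>P}. finite {u. u dvd v}"
      by (auto intro!: finite_divisors_nat intro: Nat.gr0I)
  qed
  also have "\<dots> = (\<Sum>B\<in>Pow P. card {u. u dvd \<Prod>B})"
    by (rule sum.reindex_bij_betw[symmetric]) (rule bij, simp)
  also have "\<dots> = (\<Sum>B\<in>Pow P. card (Pow B))"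
    by (intro sum.cong refl) (metis PowD bij bij_betw_same_card)
  also have "\<dots> = card (SIGMA B:Pow P. Pow B)"
    using assms(1) by (intro card_SigmaI[symmetric]) (auto intro: finite_subset)
  finally show ?thesis
    using card_subset_pairs[OF assms(1)] by simp
qed

text \<open>Each edge has a unique orientation from multiple to divisor, so edges correspond to the
  divisibility pairs off the diagonal, and the diagonal has one pair per divisor. The additive form
  avoids truncated subtraction.\<close>

lemma card_divisor_graph_edges:
  assumes "0 < n"
  shows "card {{u, v} | u v. (u, v) \<in> parcs (divisor_graph n)} + card {u. u dvd n}
    = card (SIGMA v:{v. v dvd n}. {u. u dvd v})"
proof -
  let ?C = "SIGMA v:{v. v dvd n}. {u. u dvd v}"
  let ?D = "(\<lambda>u. (u, u)) ` {u. u dvd n}"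
  let ?f = "\<lambda>(v, u). {u, v}"
  have fin: "finite ?C"
    using assms by (intro finite_SigmaI) (auto intro!: finite_divisors_nat intro: dvd_pos_nat)
  \<comment> \<open>Two pairs with the same image are equal or swapped; swapped ones would have
    entries dividing each other.\<close>
  have "inj_on ?f (?C - ?D)"
    by (rule inj_onI) (use dvd_antisym in \<open>fastforce simp: doubleton_eq_iff\<close>)
  moreover have "?f ` (?C - ?D) = {{u, v} | u v. (u, v) \<in> parcs (divisor_graph n)}" (is "_ = ?E")
  proof
    have "{u, v} \<in> ?E" if "v dvd n" "u dvd v" "u \<noteq> v" for u v
    proof -
      have "u dvd n" "0 < u" "0 < v"
        using that assms by (auto intro: dvd_trans dvd_pos_nat)
      then have "(u, v) \<in> parcs (divisor_graph n)"
        using that by (simp add: divisor_graph_def)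
      then show ?thesis by blast
    qed
    then show "?f ` (?C - ?D) \<subseteq> ?E"
      by (auto simp: image_iff)
    have "{u, v} \<in> ?f ` (?C - ?D)" if "(u, v) \<in> parcs (divisor_graph n)" for u v
    proof -
      \<comment> \<open>Either end of an arc may be the multiple, but \<open>?f\<close> sends both
        orientations to the same set.\<close>
      have "(v, u) \<in> ?C - ?D \<or> (u, v) \<in> ?C - ?D"
        using that by (auto simp: divisor_graph_def)
      then have "?f (v, u) \<in> ?f ` (?C - ?D) \<or> ?f (u, v) \<in> ?f ` (?C - ?D)"
        by (elim disjE) (rule disjI1 disjI2, erule imageI)+
      then show ?thesis
        by (simp only: case_prod_conv insert_commute[of v u] disj_absorb)
    qed
    then show "?E \<subseteq> ?f ` (?C - ?D)" by blast
  qed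
  ultimately have "card ?E = card (?C - ?D)"
    using card_image by fastforce
  moreover have "?D \<subseteq> ?C"
    by auto
  \<comment> \<open>The inequality makes the natural-number subtraction exact.\<close>
  then have "card (?C - ?D) = card ?C - card ?D" "card ?D \<le> card ?C"
    using fin by (simp_all add: card_Diff_subset card_mono finite_subset)
  moreover have "card ?D = card {u. u dvd n}"
    by (rule card_image) (auto intro: inj_onI)
  ultimately show ?thesis by simp
qed

theorem theorem3p3:
  fixes k :: nat and p :: "nat \<Rightarrow> nat"
  assumes "\<And>i. i \<in> {1..k} \<Longrightarrow> prime (p i)"
    and "inj_on p {1..k}"
  shows "wiener_index (with_proj (divisor_graph (\<Prod>i\<in>{1..k}. p i))) =
    ereal (2 ^ (2 * k) - 3 ^ k)"
proof -
  \<comment> \<open>Injectivity of \<open>p\<close> lets the set of values replace the family: it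
    has \<open>k\<close> elements and the same product.\<close>
  define P where "P = p ` {1..k}"
  define n where "n = \<Prod>P"
  have P: "finite P" "\<And>q. q \<in> P \<Longrightarrow> prime q" "card P = k"
    using assms by (auto simp: P_def card_image)
  have n: "(\<Prod>i\<in>{1..k}. p i) = n"
    using assms(2) by (simp add: n_def P_def prod.reindex)
  have "0 < n"
    unfolding n_def using P(2) by (intro prod_pos) (auto intro: prime_gt_0_nat)
  interpret pair_graph "divisor_graph n"
    using \<open>0 < n\<close> by (rule pair_graph_divisor_graph)
  have verts: "pverts (divisor_graph n) = {u. u dvd n}"
    using \<open>0 < n\<close> by (auto simp: divisor_graph_def intro: dvd_pos_nat)
  have card_verts: "card {u. u dvd n} = 2 ^ k"
    using bij_betw_same_card[OF bij_betw_Pow_divisors[OF P(1,2)]] P(1,3)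
    by (simp add: card_Pow n_def)
  have edges: "card {{u, v} | u v. (u, v) \<in> parcs (divisor_graph n)} + 2 ^ k = 3 ^ k"
    using card_divisor_graph_edges[OF \<open>0 < n\<close>] card_divisor_pairs[OF P(1,2)] P(3)
    by (simp add: card_verts flip: n_def)
  have "wiener_index (with_proj (divisor_graph n)) = ereal (2 * real (2 ^ k choose 2)
      - real (card {{u, v} | u v. (u, v) \<in> parcs (divisor_graph n)}))"
  proof -
    have "(1, v) \<in> parcs (divisor_graph n)" if "v dvd n" "v \<noteq> 1" for v
      using that \<open>0 < n\<close> by (auto simp: divisor_graph_def intro: dvd_pos_nat)
    then show ?thesis
      using wiener_index_universal_vertex[of 1] by (simp add: verts card_verts)
  qed
  also have "real (card {{u, v} | u v. (u, v) \<in> parcs (divisor_graph n)}) = 3 ^ k - 2 ^ k"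
    using arg_cong[OF edges, of real] by simp
  also have "2 * real (2 ^ k choose 2) = 2 ^ k * (2 ^ k - 1)"
  proof -
    \<comment> \<open>The halving in \<open>choose_two\<close> is exact: for \<open>k = 0\<close>
      the product is 0, otherwise \<open>2 ^ k\<close> is even.\<close>
    have "2 * (2 ^ k choose 2) = 2 ^ k * (2 ^ k - 1 :: nat)"
      by (cases k) (simp_all add: choose_two)
    from arg_cong[OF this, of real] show ?thesis by (simp add: of_nat_diff)
  qed
  \<comment> \<open>The two terms \<open>2 ^ k\<close> cancel, leaving
    \<open>2 ^ k * 2 ^ k - 3 ^ k\<close>.\<close>
  finally show ?thesis
    unfolding n by (simp add: algebra_simps power_mult power2_eq_square flip: power_mult_distrib)
qed

end
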